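(* Let $\gamma_1,\gamma_2,\gamma_3,\gamma_4,\varkappa,\varrho,\Upsilon\in\mathbb{C}$ have positive real parts, $\zeta,\mu\in\mathbb{C}$ with $\mathrm{Re}(\zeta),\mathrm{Re}(\mu)\ge0$, $\varpi_1,\varpi_2\in\mathbb{C}$, $A,B\in\mathbb{R}$. For $X>A$, $Y>B$, $$\left({}_{Y}D_{B^+}^{\zeta}\,{}_{X}D_{A^+}^{\mu}\right)\left[(X-A)^{\varkappa-1}(Y-B)^{\varrho-1}E_{\varkappa,\varrho,\Upsilon}^{(\gamma_1;\gamma_2;\gamma_3;\gamma_4)}(\varpi_1(X-A),\varpi_2(Y-B))\right]$$ $$=(X-A)^{\varkappa-\mu-1}(Y-B)^{\varrho-\zeta-1}E_{\varkappa-\mu,\varrho-\zeta,\Upsilon}^{(\gamma_1;\gamma_2;\gamma_3;\gamma_4)}(\varpi_1(X-A),\varpi_2(Y-B)).$$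
   Context: $(a)_k$ is the Pochhammer symbol. The modified bivariate H–K Mittag-Leffler function is $$E_{\varkappa,\varrho,\Upsilon}^{(\gamma_1;\gamma_2;\gamma_3;\gamma_4)}(X,Y)=\sum_{s=0}^\infty\sum_{r=0}^\infty\frac{(\gamma_1)_{2s}(\gamma_2)_{s+r}X^sY^{\Upsilon r}}{(\gamma_3)_s(\gamma_4)_s\Gamma(\varkappa+s)\Gamma(\varrho+\Upsilon r)\,r!\,s!}$$ (with $1/\Gamma$ the entire function, so the series makes sense for arbitrary complex first two subscripts). Here $(\varpi_2(Y-B))^{\Upsilon r}=(\varpi_2^\Upsilon)^r(Y-B)^{\Upsilon r}$ with a fixed value of $\varpi_2^\Upsilon$. The partial Riemann–Liouville fractional derivative is $$({}_{Y}D_{B^+}^{\zeta}\,{}_{X}D_{A^+}^{\mu})g(X,Y)=\frac{\partial^n}{\partial X^n}\frac{\partial^m}{\partial Y^m}({}_{X}I_{A^+}^{n-\mu}\,{}_{Y}I_{B^+}^{m-\zeta})g(X,Y),\quad n=[\mathrm{Re}(\mu)]+1,\ m=[\mathrm{Re}(\zeta)]+1,$$ where ${}_{X}I_{A^+}^{\lambda}f(X)=\frac{1}{\Gamma(\lambda)}\int_A^X(X-t)^{\lambda-1}f(t)\,dt$, and similarly in $Y$. *)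

theory Defs
  imports "HOL-Analysis.Analysis"
begin

text \<open>
  \<open>w\<close> is one of the values of the (in general multivalued) power \<open>z\<^sup>a\<close>. At \<open>z = 0\<close> the only
  value is taken to be \<open>0\<close>, as is appropriate for exponents with positive real part.
\<close>
definition is_power_value :: "complex \<Rightarrow> complex \<Rightarrow> complex \<Rightarrow> bool" where
  "is_power_value z a w \<longleftrightarrow>
     (if z = 0 then w = 0 else (\<exists>l. exp l = z \<and> w = exp (a * l)))"

text \<open>
  The modified bivariate H--K Mittag-Leffler function. The summand depends on the second variable
  \<open>Y\<close> only through \<open>Y\<^bsup>\<Upsilon> r\<^esup> = (Y\<^sup>\<Upsilon>)\<^sup>r\<close>. Since \<open>Y\<^sup>\<Upsilon>\<close> is
  multivalued, the last argument \<open>v\<close> is the chosen value of \<open>Y\<^sup>\<Upsilon>\<close>. In particular, the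
  factor for \<open>r = 0\<close> is \<open>1\<close> also when \<open>Y = 0\<close> (whereas \<open>0 powr 0 = 0\<close>).
\<close>
definition HK_ML ::
  "complex \<Rightarrow> complex \<Rightarrow> complex \<Rightarrow> complex \<Rightarrow> complex \<Rightarrow> complex \<Rightarrow> complex
     \<Rightarrow> complex \<Rightarrow> complex \<Rightarrow> complex" where
  "HK_ML \<gamma>1 \<gamma>2 \<gamma>3 \<gamma>4 \<kappa> \<rho> \<Upsilon> x v =
     (\<Sum>s. \<Sum>r. pochhammer \<gamma>1 (2 * s) * pochhammer \<gamma>2 (s + r) * x ^ s * v ^ r
              * rGamma (\<kappa> + of_nat s) * rGamma (\<rho> + \<Upsilon> * of_nat r)
              / (pochhammer \<gamma>3 s * pochhammer \<gamma>4 s * fact r * fact s))"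

text \<open>
  Consistency of the choice of values: if \<open>w\<close> is a value of \<open>z\<^sup>\<Upsilon>\<close> and \<open>y > 0\<close>, then
  \<open>w * y powr \<Upsilon>\<close> is a value of \<open>(z y)\<^sup>\<Upsilon>\<close>.
\<close>
lemma is_power_value_mult_pos:
  fixes y :: real
  assumes "is_power_value z a w" and "y > 0"
  shows "is_power_value (z * of_real y) a (w * of_real y powr a)"
proof (cases "z = 0")
  case True
  then show ?thesis using assms by (simp add: is_power_value_def)
next
  case False
  then obtain l where l: "exp l = z" "w = exp (a * l)"
    using assms(1) by (auto simp: is_power_value_def)
  have "exp (l + of_real (ln y)) = z * of_real y"
    using l(1) assms(2) by (simp add: exp_add exp_of_real)
  moreover have "w * of_real y powr a = exp (a * (l + of_real (ln y)))"
    using l(2) assms(2) by (simp add: powr_def exp_add distrib_left Ln_of_real)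
  ultimately show ?thesis
    using False assms(2) unfolding is_power_value_def by auto
qed

definition RL_integrand :: "real \<Rightarrow> complex \<Rightarrow> (real \<Rightarrow> complex) \<Rightarrow> real \<Rightarrow> complex" where
  "RL_integrand x \<alpha> f t = of_real (x - t) powr (\<alpha> - 1) * f t"

definition RL_integral :: "real \<Rightarrow> complex \<Rightarrow> (real \<Rightarrow> complex) \<Rightarrow> real \<Rightarrow> complex" where
  "RL_integral a \<alpha> f x = 1 / Gamma \<alpha> * (LINT t:{a<..<x}|lborel. RL_integrand x \<alpha> f t)"

definition RL_integral_X ::
  "real \<Rightarrow> complex \<Rightarrow> (real \<Rightarrow> real \<Rightarrow> complex) \<Rightarrow> real \<Rightarrow> real \<Rightarrow> complex" where
  "RL_integral_X A \<alpha> g x y = RL_integral A \<alpha> (\<lambda>t. g t y) x"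

definition RL_integral_Y ::
  "real \<Rightarrow> complex \<Rightarrow> (real \<Rightarrow> real \<Rightarrow> complex) \<Rightarrow> real \<Rightarrow> real \<Rightarrow> complex" where
  "RL_integral_Y B \<alpha> g x y = RL_integral B \<alpha> (\<lambda>t. g x t) y"

definition partial_X :: "(real \<Rightarrow> real \<Rightarrow> complex) \<Rightarrow> real \<Rightarrow> real \<Rightarrow> complex" where
  "partial_X g x y = vector_derivative (\<lambda>t. g t y) (at x)"

definition partial_Y :: "(real \<Rightarrow> real \<Rightarrow> complex) \<Rightarrow> real \<Rightarrow> real \<Rightarrow> complex" where
  "partial_Y g x y = vector_derivative (\<lambda>t. g x t) (at y)"

definition RL_order :: "complex \<Rightarrow> nat" where
  "RL_order \<mu> = nat \<lfloor>Re \<mu>\<rfloor> + 1"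

definition RL_potential ::
  "real \<Rightarrow> real \<Rightarrow> complex \<Rightarrow> complex \<Rightarrow> (real \<Rightarrow> real \<Rightarrow> complex) \<Rightarrow> real \<Rightarrow> real \<Rightarrow> complex" where
  "RL_potential A B \<mu> \<zeta> g =
     RL_integral_X A (of_nat (RL_order \<mu>) - \<mu>)
       (RL_integral_Y B (of_nat (RL_order \<zeta>) - \<zeta>) g)"

definition RL_derivative ::
  "real \<Rightarrow> real \<Rightarrow> complex \<Rightarrow> complex \<Rightarrow> (real \<Rightarrow> real \<Rightarrow> complex) \<Rightarrow> real \<Rightarrow> real \<Rightarrow> complex" where
  "RL_derivative A B \<mu> \<zeta> g =
     (partial_X ^^ RL_order \<mu>) ((partial_Y ^^ RL_order \<zeta>) (RL_potential A B \<mu> \<zeta> g))"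

text \<open>
  Integrals and derivatives are total functions with default values, so the actual existence of
  all integrals and successive partial derivatives entering \<^const>\<open>RL_derivative\<close> on the
  quadrant \<open>x > A\<close>, \<open>y > B\<close> is recorded separately.
\<close>
definition RL_derivative_exists ::
  "real \<Rightarrow> real \<Rightarrow> complex \<Rightarrow> complex \<Rightarrow> (real \<Rightarrow> real \<Rightarrow> complex) \<Rightarrow> bool" where
  "RL_derivative_exists A B \<mu> \<zeta> g \<longleftrightarrow>
     (\<forall>x>A. \<forall>y>B.
        set_integrable lborel {B<..<y} (RL_integrand y (of_nat (RL_order \<zeta>) - \<zeta>) (g x)) \<and>
        set_integrable lborel {A<..<x} (RL_integrand x (of_nat (RL_order \<mu>) - \<mu>)
          (\<lambda>t. RL_integral_Y B (of_nat (RL_order \<zeta>) - \<zeta>) g t y)) \<and>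
        (\<forall>j<RL_order \<zeta>.
           (\<lambda>t. (partial_Y ^^ j) (RL_potential A B \<mu> \<zeta> g) x t) differentiable (at y)) \<and>
        (\<forall>i<RL_order \<mu>.
           (\<lambda>t. (partial_X ^^ i) ((partial_Y ^^ RL_order \<zeta>) (RL_potential A B \<mu> \<zeta> g)) t y)
             differentiable (at x)))"

end

theory Submission
  imports Defs
begin

text \<open>
  In the variables \<open>x = X - A\<close> and \<open>y = Y - B\<close>, the function to be differentiated is a double series of
  terms \<open>T s r * (x powr (\<kappa> + s - 1) / \<Gamma>(\<kappa> + s)) * (y powr (\<rho> + \<Upsilon> r - 1) / \<Gamma>(\<rho> + \<Upsilon> r))\<close>.
  In this normalisation a fractional integral of order \<open>\<alpha>\<close> in \<open>x\<close> shifts \<open>\<kappa>\<close> to \<open>\<kappa> + \<alpha>\<close> (Beta integral), and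
  a derivative shifts \<open>\<kappa>\<close> to \<open>\<kappa> - 1\<close> (functional equation of \<open>1/\<Gamma>\<close>, valid also at the poles of
  \<open>\<Gamma>\<close>); likewise in \<open>y\<close>. Hence the fractional derivative replaces \<open>\<kappa>\<close> by
  \<open>\<kappa> + (n - \<mu>) - n = \<kappa> - \<mu>\<close> and \<open>\<rho>\<close> by \<open>\<rho> - \<zeta>\<close>. All termwise operations are justified because
  \<open>T s r\<close> grows at most geometrically in \<open>s\<close> and \<open>r\<close>, whereas \<open>1/\<Gamma>(\<rho> + \<Upsilon> r)\<close> decays faster than any
  geometric sequence.
\<close>

section \<open>Decay of the reciprocal Gamma function\<close>

text \<open>Telescoping: from the second term on, each reciprocal square is at most a difference of
  consecutive reciprocals. The negative last term keeps the induction going; only a bound uniform in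
  \<open>n\<close> is used later.\<close>

lemma sum_inverse_squares_le:
  fixes x :: real
  assumes "x > 0"
  shows "(\<Sum>k\<le>n. 1 / (x + real k)^2) \<le> 1 / x^2 + 1 / x - 1 / (x + real n)"
proof (induction n)
  case (Suc n)
  have "1 / (x + real (Suc n))^2 \<le> 1 / (x + real n) - 1 / (x + real (Suc n))"
  proof -
    have "1 / (x + real (Suc n))^2 \<le> 1 / ((x + real n) * (x + real (Suc n)))"
      using assms by (intro divide_left_mono) (auto simp: power2_eq_square intro!: mult_right_mono)
    also have "\<dots> = 1 / (x + real n) - 1 / (x + real (Suc n))"
      using assms by (simp add: field_simps)
    finally show ?thesis .
  qed
  with Suc show ?case by simp
qed simp

text \<open>With \<open>u = Re z + k\<close>, the squared modulus of a factor is
  \<open>u^2 * (1 + (Im z)^2 / u^2)\<close>, and \<open>1 + e <= exp e\<close> turns the product of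
  these corrections into one exponential of a sum.\<close>

lemma norm_pochhammer_le_exp:
  fixes z :: complex
  assumes "Re z > 0"
  shows "norm (pochhammer z (Suc n)) \<le>
           pochhammer (Re z) (Suc n) * exp ((Im z)^2 / 2 * (\<Sum>k\<le>n. 1 / (Re z + real k)^2))"
proof -
  have factor: "norm (z + of_nat k) \<le> (Re z + real k) * exp ((Im z)^2 / 2 * (1 / (Re z + real k)^2))"
    (is "_ \<le> ?u * exp ?e") for k
  proof (rule power2_le_imp_le)
    have u: "?u > 0" using assms by simp
    have "norm (z + of_nat k)^2 = ?u^2 * (1 + (Im z)^2 / ?u^2)"
      using u by (simp add: cmod_power2 field_simps)
    also have "\<dots> \<le> ?u^2 * exp ((Im z)^2 / ?u^2)"
      by (intro mult_left_mono exp_ge_add_one_self) auto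
    also have "exp ((Im z)^2 / ?u^2) = exp ?e ^ 2"
      by (simp flip: exp_of_nat_mult)
    finally show "norm (z + of_nat k)^2 \<le> (?u * exp ?e)^2"
      by (simp add: power_mult_distrib)
  qed (use assms in auto)
  show ?thesis
  proof (induction n)
    case 0
    then show ?case using factor[of 0] by simp
  next
    case (Suc n)
    have "norm (pochhammer z (Suc (Suc n))) = norm (pochhammer z (Suc n)) * norm (z + of_nat (Suc n))"
      by (subst pochhammer_Suc) (simp add: norm_mult)
    also have "\<dots> \<le> (pochhammer (Re z) (Suc n) * exp ((Im z)^2 / 2 * (\<Sum>k\<le>n. 1 / (Re z + real k)^2)))
        * ((Re z + real (Suc n)) * exp ((Im z)^2 / 2 * (1 / (Re z + real (Suc n))^2)))"
      by (intro mult_mono Suc factor mult_nonneg_nonneg pochhammer_nonneg) (use assms in auto)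
    also have "\<dots> = pochhammer (Re z) (Suc (Suc n))
        * exp ((Im z)^2 / 2 * (\<Sum>k\<le>Suc n. 1 / (Re z + real k)^2))"
      by (simp only: pochhammer_Suc[of "Re z" "Suc n"] sum.atMost_Suc distrib_left[of "(Im z)^2 / 2"] exp_add mult_ac)
    finally show ?case .
  qed
qed

text \<open>
  Substitutes for Stirling's formula off the real axis: by Euler's limit formula, passing from \<open>Re z\<close>
  to \<open>z\<close> costs only a factor that is exponential in \<open>(Im z)\<^sup>2 / Re z\<close>, which is linear along a ray.
\<close>
lemma norm_rGamma_le:
  fixes z :: complex
  assumes "Re z > 0"
  shows "norm (rGamma z) \<le> rGamma (Re z) * exp ((Im z)^2 / 2 * (1 / (Re z)^2 + 1 / Re z))"
    (is "_ \<le> _ * ?E")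
proof (rule LIMSEQ_le)
  show "(\<lambda>n. norm (rGamma_series z n)) \<longlonglongrightarrow> norm (rGamma z)"
    by (intro tendsto_norm rGamma_series_LIMSEQ)
  show "(\<lambda>n. rGamma_series (Re z) n * ?E) \<longlonglongrightarrow> rGamma (Re z) * ?E"
    by (intro tendsto_mult tendsto_const rGamma_series_LIMSEQ)
  have "norm (rGamma_series z n) \<le> rGamma_series (Re z) n * ?E" for n
  proof -
    have "(\<Sum>k\<le>n. 1 / (Re z + real k)^2) \<le> 1 / (Re z)^2 + 1 / Re z"
      using sum_inverse_squares_le[OF assms, of n] assms
      by (meson add_nonneg_nonneg diff_le_eq less_eq_real_def of_nat_0_le_iff order_trans
            le_add_same_cancel1 divide_nonneg_nonneg zero_le_one)
    then have "norm (pochhammer z (Suc n)) \<le> pochhammer (Re z) (Suc n) * ?E"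
      using assms
      by (intro order_trans[OF norm_pochhammer_le_exp[OF assms]] mult_left_mono pochhammer_nonneg)
         (auto intro!: mult_left_mono)
    moreover have "norm (fact n * exp (z * of_real (ln (of_nat n)))) = fact n * exp (Re z * ln (of_nat n))"
      by (simp add: norm_mult)
    ultimately show ?thesis
      by (simp add: rGamma_series_def norm_divide divide_right_mono)
  qed
  then show "\<exists>N. \<forall>n\<ge>N. norm (rGamma_series z n) \<le> rGamma_series (Re z) n * ?E"
    by blast
qed

text \<open>Only the tail \<open>t >= M\<close> of Euler's integral is kept; there the power is at
  least its value at \<open>M\<close> because \<open>x >= 1\<close>.\<close>

lemma Gamma_real_ge:
  fixes x M :: real
  assumes "x \<ge> 1" "M > 0"
  shows "M powr (x - 1) * exp (- M) \<le> Gamma x"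
proof (rule has_integral_le)
  have "((\<lambda>t. M powr (x - 1) * exp (- 1 * t)) has_integral M powr (x - 1) * (exp (- 1 * M) / 1)) {M..}"
    by (intro has_integral_mult_right has_integral_exp_minus_to_infinity) simp
  then have "((\<lambda>t. M powr (x - 1) * exp (- t)) has_integral M powr (x - 1) * exp (- M)) {M..}"
    by simp
  then show "((\<lambda>t. if t \<in> {M..} then M powr (x - 1) * exp (- t) else 0) has_integral
      M powr (x - 1) * exp (- M)) {0..}"
    using assms by (subst has_integral_restrict) auto
  show "((\<lambda>t. t powr (x - 1) / exp t) has_integral Gamma x) {0..}"
    using assms by (intro Gamma_integral_real) simp
  show "(if t \<in> {M..} then M powr (x - 1) * exp (- t) else 0) \<le> t powr (x - 1) / exp t" for t
    using assms by (auto simp: exp_minus field_simps intro!: powr_mono2)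
qed

text \<open>The choice \<open>M = exp L\<close> in the tail bound: any exponential rate
  \<open>L\<close> is available, at the price of a constant depending on \<open>L\<close>
  alone.\<close>

lemma rGamma_real_le:
  fixes x L :: real
  assumes "x \<ge> 1"
  shows "rGamma x \<le> exp (exp L + L) * exp (- L * x)"
proof -
  have "exp L powr (x - 1) * exp (- exp L) \<le> Gamma x"
    by (intro Gamma_real_ge assms) simp
  then have "inverse (Gamma x) \<le> inverse (exp L powr (x - 1) * exp (- exp L))"
    by (intro le_imp_inverse_le) auto
  also have "\<dots> = exp (exp L + L) * exp (- L * x)"
    by (simp add: powr_def mult_exp_exp algebra_simps flip: exp_minus)
  finally show ?thesis by (simp add: rGamma_inverse_Gamma)
qed

text \<open>Along the progression the loss from the imaginary part is exponential in
  \<open>r\<close> at a fixed rate, while the decay rate \<open>L\<close> on the real axis is free;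
  a large \<open>L\<close> beats both that loss and \<open>q\<close>.\<close>

lemma norm_rGamma_progression_le:
  fixes \<rho> \<Upsilon> :: complex and q :: real
  assumes "Re \<Upsilon> > 0" "q > 0"
  obtains K where "K \<ge> 0" "\<And>r. norm (rGamma (\<rho> + \<Upsilon> * of_nat r)) \<le> K * q ^ r"
proof -
  define a where "a = Re \<Upsilon>"
  define h where "h = \<bar>Im \<rho>\<bar> + \<bar>Im \<Upsilon>\<bar>"
  \<comment> \<open>\<open>L\<close> solves \<open>2 * h^2 / a - L * a / 2 <= ln q\<close>, the
    exponent per unit of \<open>r\<close> in the final estimate. \<open>R\<close> is the index from
    which the real part of \<open>z r\<close> is at least both \<open>1\<close> and
    \<open>a * r / 2\<close>.\<close>
  define L where "L = max 0 (2 / a * (2 * h^2 / a - ln q))"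
  define R where "R = max 1 (nat \<lceil>2 / a * (1 + \<bar>Re \<rho>\<bar>)\<rceil>)"
  define z where "z r = \<rho> + \<Upsilon> * of_nat r" for r
  have a: "a > 0" using assms by (simp add: a_def)
  have L: "L \<ge> 0" by (simp add: L_def)
  have "2 / a * (2 * h^2 / a - ln q) \<le> L" by (simp add: L_def)
  then have Lq: "2 * h^2 / a - L * a / 2 \<le> ln q"
    using a by (simp add: field_simps)
  have large: "norm (rGamma (z r)) \<le> exp (exp L + L) * q ^ r" if "r \<ge> R" for r
  proof -
    have r: "r \<ge> 1" using that by (simp add: R_def)
    have "2 / a * (1 + \<bar>Re \<rho>\<bar>) \<le> real r"
      using that unfolding R_def by linarith
    then have "1 + \<bar>Re \<rho>\<bar> \<le> a * real r / 2"
      using a by (simp add: field_simps)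
    then have x: "Re (z r) \<ge> 1" "Re (z r) \<ge> a * real r / 2"
      by (auto simp: z_def a_def)
    have "\<bar>Im (z r)\<bar> \<le> \<bar>Im \<rho>\<bar> * 1 + \<bar>Im \<Upsilon>\<bar> * real r"
      using abs_triangle_ineq[of "Im \<rho>" "Im \<Upsilon> * real r"] by (simp add: z_def abs_mult)
    also have "\<dots> \<le> \<bar>Im \<rho>\<bar> * real r + \<bar>Im \<Upsilon>\<bar> * real r"
      using r by (intro add_right_mono mult_left_mono) auto
    finally have "\<bar>Im (z r)\<bar> \<le> h * real r" by (simp add: h_def algebra_simps)
    then have im: "(Im (z r))^2 \<le> h^2 * real r^2"
      using power_mono[of "\<bar>Im (z r)\<bar>" "h * real r" 2] by (simp add: power_mult_distrib)
    have "1 / (Re (z r))^2 + 1 / Re (z r) \<le> 1 / Re (z r) + 1 / Re (z r)"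
      using x(1) by (intro add_right_mono divide_left_mono) (auto simp: power2_eq_square)
    also have "\<dots> = 2 / Re (z r)" by simp
    also have "\<dots> \<le> 2 / (a * real r / 2)"
      using x a r by (intro divide_left_mono) auto
    finally have "(Im (z r))^2 / 2 * (1 / (Re (z r))^2 + 1 / Re (z r))
        \<le> (h^2 * real r^2) / 2 * (2 / (a * real r / 2))"
      using im x(1) by (intro mult_mono) auto
    also have "\<dots> = 2 * h^2 / a * real r"
      using a r by (simp add: field_simps power2_eq_square)
    finally have e: "(Im (z r))^2 / 2 * (1 / (Re (z r))^2 + 1 / Re (z r)) \<le> 2 * h^2 / a * real r" .
    have "norm (rGamma (z r)) \<le> rGamma (Re (z r)) * exp ((Im (z r))^2 / 2 * (1 / (Re (z r))^2 + 1 / Re (z r)))"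
      using x by (intro norm_rGamma_le) simp
    also have "\<dots> \<le> (exp (exp L + L) * exp (- L * Re (z r))) * exp (2 * h^2 / a * real r)"
      using e x(1) by (intro mult_mono rGamma_real_le) auto
    also have "\<dots> \<le> (exp (exp L + L) * exp (- L * (a * real r / 2))) * exp (2 * h^2 / a * real r)"
      using mult_left_mono[OF x(2) L] by (intro mult_right_mono mult_left_mono) auto
    also have "\<dots> = exp (exp L + L) * exp (real r * (2 * h^2 / a - L * a / 2))"
      by (simp add: mult_exp_exp algebra_simps)
    also have "\<dots> \<le> exp (exp L + L) * exp (real r * ln q)"
      using Lq by (intro mult_left_mono) (auto intro!: mult_left_mono)
    also have "exp (real r * ln q) = q ^ r"
      using assms by (simp add: exp_of_nat_mult)
    finally show ?thesis .
  qed
  \<comment> \<open>The finitely many indices below \<open>R\<close> are absorbed into the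
    constant.\<close>
  define K where "K = exp (exp L + L) + (\<Sum>r<R. norm (rGamma (z r)) / q ^ r)"
  have nn: "(\<Sum>r<R. norm (rGamma (z r)) / q ^ r) \<ge> 0"
    using assms by (intro sum_nonneg) auto
  have "norm (rGamma (z r)) \<le> K * q ^ r" for r
  proof (cases "r < R")
    case True
    have "norm (rGamma (z r)) / q ^ r \<le> (\<Sum>r<R. norm (rGamma (z r)) / q ^ r)"
      using True assms by (intro member_le_sum) auto
    also have "\<dots> \<le> K" by (simp add: K_def)
    finally show ?thesis using assms by (simp add: field_simps)
  next
    case False
    then have "norm (rGamma (z r)) \<le> exp (exp L + L) * q ^ r" by (intro large) simp
    also have "\<dots> \<le> K * q ^ r" using nn assms by (intro mult_right_mono) (auto simp: K_def)
    finally show ?thesis .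
  qed
  moreover have "K \<ge> 0" using nn by (simp add: K_def add_nonneg_nonneg)
  ultimately show ?thesis using that unfolding z_def by blast
qed

section \<open>The complex Beta integral\<close>

text \<open>Euler's integral as a Bochner integral over \<open>lborel\<close>, the form that
  Fubini's theorem needs. Borel measurability of the integrand allows the passage from the completed
  measure.\<close>

lemma has_bochner_integral_Gamma:
  fixes z :: complex
  assumes "Re z > 0"
  shows "has_bochner_integral lborel
           (\<lambda>t. indicat_real {0<..} t *\<^sub>R (of_real t powr (z - 1) * of_real (exp (- t)))) (Gamma z)"
    (is "has_bochner_integral _ ?f _")
proof -
  have eq: "?f = (\<lambda>t. indicat_real {0<..} t *\<^sub>R (of_real t powr (z - 1) / of_real (exp t)))"
    by (simp add: exp_minus fun_eq_iff divide_inverse)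
  have meas: "?f \<in> borel_measurable lborel"
    unfolding measurable_lborel2
    by (intro borel_measurable_continuous_on_indicator continuous_intros) auto
  have int: "integrable lborel ?f"
    using absolutely_integrable_Gamma_integral'[OF assms] meas
    unfolding set_integrable_def eq by (simp add: integrable_completion)
  then have "integral\<^sup>L lborel ?f = integral {0<..} (\<lambda>t. of_real t powr (z - 1) / of_real (exp t))"
    using set_borel_integral_eq_integral(2)[of "{0<..}" "\<lambda>t. of_real t powr (z - 1) / of_real (exp t)"]
    unfolding set_integrable_def set_lebesgue_integral_def eq by simp
  also have "\<dots> = Gamma z"
    by (intro integral_unique Gamma_integral_complex' assms)
  finally show ?thesis using int by (simp add: has_bochner_integral_iff)
qed

text \<open>The integrand of the fractional integral of order \<open>a\<close>, based at 0, of the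
  power with exponent \<open>b - 1\<close>. The built-in indicator makes it a function on the whole
  line, ready for affine substitutions.\<close>

definition beta_kernel :: "complex \<Rightarrow> complex \<Rightarrow> real \<Rightarrow> real \<Rightarrow> complex" where
  "beta_kernel a b x t = indicat_real {0<..<x} t *\<^sub>R (of_real (x - t) powr (a - 1) * of_real t powr (b - 1))"

lemma borel_measurable_beta_kernel [measurable]: "beta_kernel a b x \<in> borel_measurable borel"
  unfolding beta_kernel_def[abs_def]
  by (intro borel_measurable_continuous_on_indicator continuous_intros) auto

lemma norm_beta_kernel:
  "norm (beta_kernel a b x t) = indicat_real {0<..<x} t * ((x - t) powr (Re a - 1) * t powr (Re b - 1))"
  by (auto simp: beta_kernel_def norm_mult norm_powr_real_powr indicator_def)

lemma beta_kernel_scale: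
  assumes "x > 0"
  shows "beta_kernel a b x (x * t) = of_real x powr (a + b - 2) * beta_kernel a b 1 t"
proof (cases "t \<in> {0<..<1}")
  case True
  have "complex_of_real (x - x * t) powr (a - 1) = of_real x powr (a - 1) * of_real (1 - t) powr (a - 1)"
    using True assms powr_times_real[of "of_real x" "of_real (1 - t)" "a - 1"]
    by (simp add: algebra_simps)
  moreover have "complex_of_real (x * t) powr (b - 1) = of_real x powr (b - 1) * of_real t powr (b - 1)"
    using True assms powr_times_real[of "of_real x" "of_real t" "b - 1"] by simp
  moreover have "complex_of_real x powr (a - 1) * of_real x powr (b - 1) = of_real x powr (a + b - 2)"
    by (simp add: algebra_simps flip: powr_add)
  moreover have "x * t \<in> {0<..<x}" using True assms by auto
  ultimately show ?thesis using True by (simp add: beta_kernel_def mult_ac)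
next
  case False
  then have "x * t \<notin> {0<..<x}" using assms by (auto simp: zero_less_mult_iff)
  then show ?thesis using False by (simp add: beta_kernel_def)
qed

lemma integrable_beta_kernel_1:
  assumes "Re a > 0" "Re b > 0"
  shows "integrable lborel (beta_kernel a b 1)"
proof (rule Bochner_Integration.integrable_bound)
  show "integrable lborel (\<lambda>t. indicat_real {0..1} t *\<^sub>R (t powr (Re b - 1) * (1 - t) powr (Re a - 1)))"
    using integrable_Beta[of "Re b" "Re a"] assms by (simp add: set_integrable_def)
  show "AE t in lborel. norm (beta_kernel a b 1 t) \<le>
      norm (indicat_real {0..1} t *\<^sub>R (t powr (Re b - 1) * (1 - t) powr (Re a - 1)))"
    by (intro AE_I2) (auto simp: norm_beta_kernel indicator_def)
qed simp

text \<open>Substituting \<open>x * t\<close> for \<open>t\<close>: the kernel is homogeneous of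
  degree \<open>a + b - 2\<close>, and the Jacobian contributes one more power of
  \<open>x\<close>.\<close>

lemma beta_kernel_integral:
  assumes "x > 0"
  shows "integral\<^sup>L lborel (beta_kernel a b x)
           = of_real x powr (a + b - 1) * integral\<^sup>L lborel (beta_kernel a b 1)"
proof -
  have "integral\<^sup>L lborel (beta_kernel a b x) = x *\<^sub>R (\<integral>t. beta_kernel a b x (0 + x * t) \<partial>lborel)"
    using lborel_integral_real_affine[of x "beta_kernel a b x" 0] assms by simp
  also have "\<dots> = of_real x * of_real x powr (a + b - 2) * integral\<^sup>L lborel (beta_kernel a b 1)"
    by (simp add: beta_kernel_scale[OF assms] scaleR_conv_of_real)
  also have "complex_of_real x * of_real x powr (a + b - 2) = of_real x powr 1 * of_real x powr (a + b - 2)"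
    using assms by simp
  also have "\<dots> = of_real x powr (a + b - 1)"
    by (subst powr_add[symmetric]) (simp add: algebra_simps)
  finally show ?thesis .
qed

lemma integrable_beta_kernel:
  assumes "Re a > 0" "Re b > 0"
  shows "integrable lborel (beta_kernel a b x)"
proof (cases "x > 0")
  case True
  have "integrable lborel (\<lambda>t. beta_kernel a b x (0 + x * t))"
    using integrable_beta_kernel_1[OF assms] by (simp add: beta_kernel_scale[OF True])
  then show ?thesis
    using True lborel_integrable_real_affine_iff[of x "beta_kernel a b x" 0] by simp
qed (simp add: beta_kernel_def[abs_def])

lemma integral_beta_kernel_1:
  assumes a: "Re a > 0" and b: "Re b > 0"
  shows "Gamma (a + b) * integral\<^sup>L lborel (beta_kernel a b 1) = Gamma a * Gamma b"
proof -
  \<comment> \<open>Both sides are the integral of \<open>(u - t) powr (a - 1) * t powr (b - 1) * exp (- u)\<close> over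
    \<open>0 < t < u\<close>, with the two orders of integration.\<close>
  define F where "F a b p = indicat_real {p. 0 < fst p \<and> fst p < snd p} p *\<^sub>R
      (of_real (snd p - fst p) powr (a - 1) * of_real (fst p) powr (b - 1) * of_real (exp (- snd p)))"
    for a b :: complex and p :: "real \<times> real"
  define h where "h a t = indicat_real {0<..} t *\<^sub>R (of_real t powr (a - 1) * complex_of_real (exp (- t)))"
    for a :: complex and t :: real
  have h: "has_bochner_integral lborel (h a) (Gamma a)" if "Re a > 0" for a
    using has_bochner_integral_Gamma[OF that] by (simp add: h_def[abs_def])
  have "open {p :: real \<times> real. 0 < fst p \<and> fst p < snd p}"
    by (intro open_Collect_conj open_Collect_less continuous_intros)
  then have F_meas: "F a b \<in> borel_measurable (lborel \<Otimes>\<^sub>M lborel)" for a b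
    unfolding lborel_prod measurable_lborel2 F_def[abs_def]
    by (intro borel_measurable_continuous_on_indicator continuous_intros) auto
  have inner: "has_bochner_integral lborel (\<lambda>u. F a b (t, u)) (h b t * Gamma a)"
    if "Re a > 0" for a b t
  proof -
    \<comment> \<open>Since \<open>exp (- u)\<close> splits as
      \<open>exp (- t) * exp (- (u - t))\<close>, the section at fixed \<open>t\<close> is a
      translated Gamma integrand.\<close>
    have "F a b (t, u) = h b t * h a (- t + 1 * u)" for u
    proof (cases "0 < t \<and> t < u")
      case True
      have "complex_of_real (exp (- u)) = of_real (exp (- t)) * of_real (exp (- (- t + 1 * u)))"
        by (simp add: exp_add[symmetric] flip: of_real_mult)
      with True show ?thesis by (simp add: F_def h_def del: of_real_exp)
    qed (auto simp: F_def h_def indicator_def)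
    moreover have "has_bochner_integral lborel (\<lambda>u. h a (- t + 1 * u)) (Gamma a)"
      using lborel_has_bochner_integral_real_affine_iff[of 1 "h a" "Gamma a" "-t"] h[OF that] by simp
    ultimately show ?thesis by (simp add: has_bochner_integral_mult_right)
  qed
  \<comment> \<open>The modulus of \<open>F\<close> is \<open>F\<close> again, with the real parts
    as parameters. Hence \<open>inner\<close>, proved for arbitrary parameters, also evaluates the
    integrals of norms required by Fubini.\<close>
  have norm_F: "norm (F a b p) = Re (F (of_real (Re a)) (of_real (Re b)) p)" for p
  proof (cases "0 < fst p \<and> fst p < snd p")
    case True
    then have "complex_of_real (snd p - fst p) powr (of_real (Re a) - 1) = of_real ((snd p - fst p) powr (Re a - 1))"
      and "complex_of_real (fst p) powr (of_real (Re b) - 1) = of_real (fst p powr (Re b - 1))"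
      using powr_of_real[of "snd p - fst p" "Re a - 1"] powr_of_real[of "fst p" "Re b - 1"] by simp_all
    with True show ?thesis
      unfolding F_def by (simp add: norm_mult norm_powr_real_powr del: of_real_diff of_real_exp)
  qed (simp add: F_def)
  have "(\<integral>u. norm (F a b (t, u)) \<partial>lborel) = Re (h (of_real (Re b)) t * Gamma (of_real (Re a)))" for t
  proof -
    have "has_bochner_integral lborel (\<lambda>u. norm (F a b (t, u)))
        (Re (h (of_real (Re b)) t * Gamma (of_real (Re a))))"
      unfolding norm_F using a
      by (intro has_bochner_integral_bounded_linear[OF bounded_linear_Re] inner) simp
    then show ?thesis by (rule has_bochner_integral_integral_eq)
  qed
  moreover have "integrable lborel (\<lambda>t. Re (h (of_real (Re b)) t * Gamma (of_real (Re a))))"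
    using h[of "of_real (Re b)"] b by (intro integrable_Re integrable_mult_left) (simp add: has_bochner_integral_iff)
  ultimately have "integrable lborel (\<lambda>t. \<integral>u. norm (F a b (t, u)) \<partial>lborel)" by simp
  then have int: "integrable (lborel \<Otimes>\<^sub>M lborel) (F a b)"
    using inner[OF a, of b] by (intro lborel_pair.Fubini_integrable F_meas) (auto simp: has_bochner_integral_iff)
  have "(\<integral>u. (\<integral>t. F a b (t, u) \<partial>lborel) \<partial>lborel) = (\<integral>t. (\<integral>u. F a b (t, u) \<partial>lborel) \<partial>lborel)"
    by (rule lborel_pair.Fubini_integral) (use int in simp)
  also have "\<dots> = (\<integral>t. h b t * Gamma a \<partial>lborel)"
    using inner[OF a, THEN has_bochner_integral_integral_eq] by simp
  also have "\<dots> = Gamma b * Gamma a"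
    using h[OF b] by (intro has_bochner_integral_integral_eq has_bochner_integral_mult_left)
  finally have *: "(\<integral>u. (\<integral>t. F a b (t, u) \<partial>lborel) \<partial>lborel) = Gamma a * Gamma b"
    by (simp add: mult_ac)
  \<comment> \<open>In the other order the section at fixed \<open>u\<close> is a beta kernel on the
    interval from 0 to \<open>u\<close>; rescaling it to the unit interval leaves the Gamma
    integrand with parameter \<open>a + b\<close>.\<close>
  have "(\<integral>t. F a b (t, u) \<partial>lborel) = h (a + b) u * integral\<^sup>L lborel (beta_kernel a b 1)" for u
  proof (cases "u > 0")
    case True
    have "F a b (t, u) = of_real (exp (- u)) * beta_kernel a b u t" for t
      by (auto simp: F_def beta_kernel_def indicator_def)
    then have "(\<integral>t. F a b (t, u) \<partial>lborel) = of_real (exp (- u)) * integral\<^sup>L lborel (beta_kernel a b u)"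
      by simp
    then show ?thesis using True by (simp add: beta_kernel_integral[OF True] h_def mult_ac)
  next
    case False
    then have "F a b (t, u) = 0" for t by (auto simp: F_def)
    then show ?thesis using False by (simp add: h_def)
  qed
  then have "(\<integral>u. (\<integral>t. F a b (t, u) \<partial>lborel) \<partial>lborel)
      = (\<integral>u. h (a + b) u * integral\<^sup>L lborel (beta_kernel a b 1) \<partial>lborel)"
    by simp
  also have "\<dots> = Gamma (a + b) * integral\<^sup>L lborel (beta_kernel a b 1)"
    using h[of "a + b"] a b by (intro has_bochner_integral_integral_eq has_bochner_integral_mult_left) simp
  finally show ?thesis using * by simp
qed

lemma Gamma_neq_0_Re_pos: "Re z > 0 \<Longrightarrow> Gamma z \<noteq> (0 :: complex)"
  by (auto simp: Gamma_eq_zero_iff elim!: nonpos_Ints_cases)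

lemma integral_beta_kernel:
  assumes "Re a > 0" "Re b > 0" "x > 0"
  shows "integral\<^sup>L lborel (beta_kernel a b x) = Gamma a * Gamma b * rGamma (a + b) * of_real x powr (a + b - 1)"
proof -
  have "Gamma (a + b) \<noteq> 0" using assms by (intro Gamma_neq_0_Re_pos) simp
  then have "integral\<^sup>L lborel (beta_kernel a b 1) = Gamma a * Gamma b * rGamma (a + b)"
    using integral_beta_kernel_1[OF assms(1,2)] by (simp add: rGamma_inverse_Gamma field_simps)
  then show ?thesis by (simp add: beta_kernel_integral[OF assms(3)] mult_ac)
qed

section \<open>Gamma-normalised power series\<close>

text \<open>These are the coefficient sequences of power series with positive radius of
  convergence.\<close>

definition geometrically_bounded :: "(nat \<Rightarrow> complex) \<Rightarrow> bool" where
  "geometrically_bounded c \<longleftrightarrow> (\<exists>K D. D \<ge> 0 \<and> (\<forall>r. norm (c r) \<le> K * D ^ r))"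

lemma summable_geometrically_bounded_rGamma:
  assumes "geometrically_bounded c" "Re \<Upsilon> > 0" "M \<ge> 0"
  shows "summable (\<lambda>r. norm (c r * rGamma (\<rho> + \<Upsilon> * of_nat r)) * M ^ r)"
proof -
  obtain K D where D: "D \<ge> 0" and c: "\<And>r. norm (c r) \<le> K * D ^ r"
    using assms(1) by (auto simp: geometrically_bounded_def)
  have K: "K \<ge> 0" using order_trans[OF norm_ge_zero c[of 0]] by simp
  \<comment> \<open>\<open>q\<close> makes the ratio \<open>D * M * q\<close> at most one half; the
    summand \<open>1\<close> covers the case \<open>D * M = 0\<close>.\<close>
  define q where "q = 1 / (2 * (D * M + 1))"
  have DM: "D * M \<ge> 0" using D assms(3) by simp
  then have q: "q > 0" "D * M * q \<le> 1 / 2" by (auto simp: q_def field_simps)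
  obtain K' where K': "K' \<ge> 0" "\<And>r. norm (rGamma (\<rho> + \<Upsilon> * of_nat r)) \<le> K' * q ^ r"
    using norm_rGamma_progression_le[OF assms(2) q(1)] by metis
  show ?thesis
  proof (rule summable_comparison_test')
    show "summable (\<lambda>r. K * K' * (1 / 2) ^ r :: real)"
      by (intro summable_mult summable_geometric) auto
    fix r :: nat
    have "norm (c r * rGamma (\<rho> + \<Upsilon> * of_nat r)) * M ^ r \<le> (K * D ^ r) * (K' * q ^ r) * M ^ r"
      unfolding norm_mult using c K' K D assms(3) by (intro mult_right_mono mult_mono) auto
    also have "\<dots> = K * K' * (D * M * q) ^ r" by (simp add: power_mult_distrib)
    also have "\<dots> \<le> K * K' * (1 / 2) ^ r"
      using K K'(1) q DM by (intro mult_left_mono power_mono) auto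
    finally show "norm (norm (c r * rGamma (\<rho> + \<Upsilon> * of_nat r)) * M ^ r) \<le> K * K' * (1 / 2) ^ r"
      using assms(3) by simp
  qed
qed

text \<open>Writing \<open>rGamma\<close> as a factor keeps the term meaningful for every complex
  \<rho>: at a pole of Gamma it is zero. This matters once derivatives have moved \<rho> to the
  left.\<close>

definition gamma_term :: "(nat \<Rightarrow> complex) \<Rightarrow> complex \<Rightarrow> complex \<Rightarrow> nat \<Rightarrow> real \<Rightarrow> complex" where
  "gamma_term c \<rho> \<Upsilon> r y =
     c r * rGamma (\<rho> + \<Upsilon> * of_nat r) * of_real y powr (\<rho> + \<Upsilon> * of_nat r - 1)"

definition gamma_series :: "(nat \<Rightarrow> complex) \<Rightarrow> complex \<Rightarrow> complex \<Rightarrow> real \<Rightarrow> complex" where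
  "gamma_series c \<rho> \<Upsilon> y = (\<Sum>r. gamma_term c \<rho> \<Upsilon> r y)"

lemma norm_gamma_term:
  assumes "y > 0"
  shows "norm (gamma_term c \<rho> \<Upsilon> r y)
           = norm (c r * rGamma (\<rho> + \<Upsilon> * of_nat r)) * (y powr Re \<Upsilon>) ^ r * y powr (Re \<rho> - 1)"
proof -
  have "norm (complex_of_real y powr (\<rho> + \<Upsilon> * of_nat r - 1)) = y powr (Re \<rho> - 1 + Re \<Upsilon> * real r)"
    using assms by (simp add: norm_powr_real_powr algebra_simps)
  also have "\<dots> = (y powr Re \<Upsilon>) ^ r * y powr (Re \<rho> - 1)"
    using assms by (simp add: powr_add powr_powr[symmetric] powr_realpow)
  finally show ?thesis by (simp add: gamma_term_def norm_mult)
qed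

lemma summable_norm_gamma_term:
  assumes "geometrically_bounded c" "Re \<Upsilon> > 0" "y > 0"
  shows "summable (\<lambda>r. norm (gamma_term c \<rho> \<Upsilon> r y))"
  unfolding norm_gamma_term[OF assms(3)]
  by (intro summable_mult2 summable_geometrically_bounded_rGamma assms(1,2)) simp

text \<open>\<open>rGamma_plus1\<close> absorbs the factor produced by the power rule, without a
  case distinction at the poles.\<close>

lemma has_vector_derivative_gamma_term:
  assumes "y > 0"
  shows "(gamma_term c \<rho> \<Upsilon> r has_vector_derivative gamma_term c (\<rho> - 1) \<Upsilon> r y) (at y)"
proof -
  let ?z = "\<rho> + \<Upsilon> * of_nat r - 1"
  have "((\<lambda>w. w powr ?z) has_field_derivative ?z * of_real y powr (?z - 1)) (at (complex_of_real y))"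
    using assms by (intro has_field_derivative_powr) auto
  then have "((\<lambda>y. complex_of_real y powr ?z) has_vector_derivative ?z * of_real y powr (?z - 1)) (at y)"
    by (rule has_vector_derivative_real_field)
  from has_vector_derivative_mult_right[OF this, of "c r * rGamma (?z + 1)"]
  have "(gamma_term c \<rho> \<Upsilon> r has_vector_derivative
      c r * rGamma (?z + 1) * (?z * of_real y powr (?z - 1))) (at y)"
    by (simp add: gamma_term_def[abs_def])
  also have "c r * rGamma (?z + 1) * (?z * of_real y powr (?z - 1))
      = c r * (?z * rGamma (?z + 1)) * of_real y powr (?z - 1)"
    by (simp only: mult_ac)
  also have "\<dots> = gamma_term c (\<rho> - 1) \<Upsilon> r y"
    unfolding rGamma_plus1 by (simp add: gamma_term_def algebra_simps)
  finally show ?thesis .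
qed

text \<open>Termwise differentiation: the series of derivatives has the same shape with
  \<open>\<rho> - 1\<close> and converges uniformly near \<open>y\<close> by the Weierstrass
  M-test.\<close>

lemma has_vector_derivative_gamma_series:
  assumes c: "geometrically_bounded c" and \<Upsilon>: "Re \<Upsilon> > 0" and y: "y > 0"
  shows "(gamma_series c \<rho> \<Upsilon> has_vector_derivative gamma_series c (\<rho> - 1) \<Upsilon> y) (at y)"
proof -
  let ?S = "{y / 2<..<2 * y}"
  define N where "N r = norm (c r * rGamma (\<rho> - 1 + \<Upsilon> * of_nat r)) * ((2 * y) powr Re \<Upsilon>) ^ r
      * ((y / 2) powr (Re \<rho> - 2) + (2 * y) powr (Re \<rho> - 2))" for r
  have "uniform_limit ?S (\<lambda>n x. \<Sum>r<n. gamma_term c (\<rho> - 1) \<Upsilon> r x) (gamma_series c (\<rho> - 1) \<Upsilon>) sequentially"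
    unfolding gamma_series_def[abs_def]
  proof (rule Weierstrass_m_test)
    show "summable N"
      unfolding N_def by (intro summable_mult2 summable_geometrically_bounded_rGamma c \<Upsilon>) simp
    fix r x assume x: "x \<in> ?S"
    have "x powr (Re \<rho> - 2) \<le> (y / 2) powr (Re \<rho> - 2) + (2 * y) powr (Re \<rho> - 2)"
    proof (cases "Re \<rho> \<ge> 2")
      case True
      then have "x powr (Re \<rho> - 2) \<le> (2 * y) powr (Re \<rho> - 2)"
        using x y by (intro powr_mono2) auto
      then show ?thesis by (simp add: add_increasing)
    next
      case False
      then have "x powr (Re \<rho> - 2) \<le> (y / 2) powr (Re \<rho> - 2)"
        using x y by (intro powr_mono2') auto
      then show ?thesis by (simp add: add_increasing2)
    qed
    moreover have "(x powr Re \<Upsilon>) ^ r \<le> ((2 * y) powr Re \<Upsilon>) ^ r"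
      using x y \<Upsilon> by (intro power_mono powr_mono2) auto
    moreover have "x > 0" using x y by auto
    ultimately show "norm (gamma_term c (\<rho> - 1) \<Upsilon> r x) \<le> N r"
      by (simp add: norm_gamma_term N_def mult_mono)
  qed
  \<comment> \<open>Uniform convergence restated for the derivatives as linear maps in
    \<open>h\<close>, as \<open>has_derivative_series\<close> expects.\<close>
  then have lim: "\<forall>\<^sub>F n in sequentially. \<forall>x\<in>?S. \<forall>h.
      norm ((\<Sum>r<n. h *\<^sub>R gamma_term c (\<rho> - 1) \<Upsilon> r x) - h *\<^sub>R gamma_series c (\<rho> - 1) \<Upsilon> x) \<le> e * norm h"
    if "e > 0" for e
    using that unfolding uniform_limit_iff
    by (fastforce elim!: allE[of _ e] eventually_mono
        simp: dist_norm mult.commute[of e] mult_left_mono less_imp_le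
        simp flip: scaleR_sum_right scaleR_diff_right)
  have "\<exists>g. \<forall>x\<in>?S. (\<lambda>r. gamma_term c \<rho> \<Upsilon> r x) sums g x \<and>
      (g has_derivative (\<lambda>h. h *\<^sub>R gamma_series c (\<rho> - 1) \<Upsilon> x)) (at x within ?S)"
  proof (rule has_derivative_series)
    show "(gamma_term c \<rho> \<Upsilon> n has_derivative (\<lambda>h. h *\<^sub>R gamma_term c (\<rho> - 1) \<Upsilon> n x)) (at x within ?S)"
      if "x \<in> ?S" for n x
      using has_vector_derivative_gamma_term[of x] that y
      by (auto simp: has_vector_derivative_def intro: has_derivative_at_withinI)
    show "y \<in> ?S" using y by simp
    show "(\<lambda>r. gamma_term c \<rho> \<Upsilon> r y) sums gamma_series c \<rho> \<Upsilon> y"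
      unfolding gamma_series_def
      by (intro summable_sums summable_norm_cancel[OF summable_norm_gamma_term] assms)
  qed (use lim in auto)
  then obtain g where g: "\<And>x. x \<in> ?S \<Longrightarrow> (\<lambda>r. gamma_term c \<rho> \<Upsilon> r x) sums g x"
    "\<And>x. x \<in> ?S \<Longrightarrow> (g has_vector_derivative gamma_series c (\<rho> - 1) \<Upsilon> x) (at x within ?S)"
    unfolding has_vector_derivative_def by blast
  have "(g has_vector_derivative gamma_series c (\<rho> - 1) \<Upsilon> y) (at y)"
    using g(2)[of y] y by (simp add: at_within_open[of y ?S])
  then show ?thesis
    by (rule has_vector_derivative_transform_within_open[of _ _ _ ?S])
       (use g(1) y in \<open>auto simp: gamma_series_def sums_iff\<close>)
qed

section \<open>Termwise fractional integration of one-variable series\<close>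

text \<open>Each term is a Beta integral, and sum and integral commute because the integrals of
  norms are summable. \<open>Re \<rho> > 0\<close> controls the singularity at 0 and
  \<open>Re \<alpha> > 0\<close> the one at \<open>x\<close>.\<close>

lemma integral_RL_gamma_series:
  assumes c: "geometrically_bounded c" and \<Upsilon>: "Re \<Upsilon> > 0"
    and \<alpha>: "Re \<alpha> > 0" and \<rho>: "Re \<rho> > 0" and x: "x > 0"
  defines "f \<equiv> \<lambda>t. indicat_real {0<..<x} t *\<^sub>R (of_real (x - t) powr (\<alpha> - 1) * gamma_series c \<rho> \<Upsilon> t)"
  shows "integrable lborel f" "integral\<^sup>L lborel f = Gamma \<alpha> * gamma_series c (\<rho> + \<alpha>) \<Upsilon> x"
proof -
  define k where "k r = c r * rGamma (\<rho> + \<Upsilon> * of_nat r)" for r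
  define F where "F r t = k r * beta_kernel \<alpha> (\<rho> + \<Upsilon> * of_nat r) x t" for r t
  have Re: "Re (\<rho> + \<Upsilon> * of_nat r) > 0" for r
    using \<Upsilon> \<rho> by (simp add: add_pos_nonneg)
  have F_eq: "F r t = indicat_real {0<..<x} t *\<^sub>R (of_real (x - t) powr (\<alpha> - 1) * gamma_term c \<rho> \<Upsilon> r t)" for r t
    by (simp add: F_def k_def beta_kernel_def gamma_term_def mult_ac)
  have F_int: "integrable lborel (F r)" for r
    unfolding F_def using Re \<alpha> by (intro integrable_mult_right integrable_beta_kernel)
  define B where "B = (\<integral>t. norm (beta_kernel \<alpha> \<rho> x t) \<partial>lborel)"
  \<comment> \<open>Replacing \<open>t\<close> by \<open>x\<close> in the part of the power that
    depends on \<open>r\<close> leaves the single kernel of index 0, so its integral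
    \<open>B\<close> serves for all \<open>r\<close>.\<close>
  have F_norm: "norm (F r t) \<le> norm (k r) * (x powr Re \<Upsilon>) ^ r * norm (beta_kernel \<alpha> \<rho> x t)" for r t
  proof (cases "t \<in> {0<..<x}")
    case True
    then have "t powr (Re (\<rho> + \<Upsilon> * of_nat r) - 1) = (t powr Re \<Upsilon>) ^ r * t powr (Re \<rho> - 1)"
      by (simp add: algebra_simps powr_add powr_diff powr_powr[symmetric] powr_realpow)
    also have "\<dots> \<le> (x powr Re \<Upsilon>) ^ r * t powr (Re \<rho> - 1)"
      using True \<Upsilon> by (intro mult_right_mono power_mono powr_mono2) auto
    finally have "t powr (Re (\<rho> + \<Upsilon> * of_nat r) - 1) \<le> (x powr Re \<Upsilon>) ^ r * t powr (Re \<rho> - 1)" .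
    then have "norm (k r) * ((x - t) powr (Re \<alpha> - 1) * t powr (Re (\<rho> + \<Upsilon> * of_nat r) - 1))
       \<le> norm (k r) * ((x - t) powr (Re \<alpha> - 1) * ((x powr Re \<Upsilon>) ^ r * t powr (Re \<rho> - 1)))"
      by (intro mult_left_mono) auto
    then show ?thesis
      using True by (simp add: F_def norm_mult norm_beta_kernel mult_ac)
  qed (simp add: F_def norm_mult norm_beta_kernel)
  have sum_norm: "summable (\<lambda>r. \<integral>t. norm (F r t) \<partial>lborel)"
  proof (rule summable_comparison_test')
    show "summable (\<lambda>r. norm (k r) * (x powr Re \<Upsilon>) ^ r * B)"
      unfolding k_def by (intro summable_mult2 summable_geometrically_bounded_rGamma c \<Upsilon>) simp
    fix r :: nat
    have "(\<integral>t. norm (F r t) \<partial>lborel) \<le> (\<integral>t. norm (k r) * (x powr Re \<Upsilon>) ^ r * norm (beta_kernel \<alpha> \<rho> x t) \<partial>lborel)"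
      using F_int F_norm integrable_beta_kernel[OF \<alpha> \<rho>]
      by (intro integral_mono integrable_norm integrable_mult_right) auto
    then show "norm (\<integral>t. norm (F r t) \<partial>lborel) \<le> norm (k r) * (x powr Re \<Upsilon>) ^ r * B"
      by (simp add: B_def)
  qed
  have pointwise: "summable (\<lambda>r. norm (F r t))" "(\<Sum>r. F r t) = f t" for t
  proof -
    show "summable (\<lambda>r. norm (F r t))"
      using summable_norm_gamma_term[OF c \<Upsilon>, of t \<rho>]
      by (cases "t \<in> {0<..<x}") (auto simp: F_eq norm_mult intro: summable_mult)
    show "(\<Sum>r. F r t) = f t"
      using summable_norm_gamma_term[OF c \<Upsilon>, of t \<rho>, THEN summable_norm_cancel]
      by (cases "t \<in> {0<..<x}") (auto simp: F_eq f_def gamma_series_def suminf_mult)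
  qed
  have int_F: "integral\<^sup>L lborel (F r) = Gamma \<alpha> * gamma_term c (\<rho> + \<alpha>) \<Upsilon> r x" for r
  proof -
    \<comment> \<open>The Gamma value from the Beta integral cancels against the normalising
      \<open>rGamma\<close>.\<close>
    have "Gamma (\<rho> + \<Upsilon> * of_nat r) \<noteq> 0" by (intro Gamma_neq_0_Re_pos Re)
    then show ?thesis
      unfolding F_def using integral_beta_kernel[OF \<alpha> Re x, of r]
      by (simp add: k_def gamma_term_def rGamma_inverse_Gamma[of "\<rho> + \<Upsilon> * of_nat r"] add_ac)
  qed
  note sums = F_int AE_I2[OF pointwise(1)] sum_norm
  show "integrable lborel f"
    using integrable_suminf[of lborel F, OF sums] by (simp add: pointwise)
  have "integral\<^sup>L lborel f = (\<Sum>r. Gamma \<alpha> * gamma_term c (\<rho> + \<alpha>) \<Upsilon> r x)"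
    using integral_suminf[of lborel F, OF sums] by (simp add: pointwise int_F)
  also have "\<dots> = Gamma \<alpha> * gamma_series c (\<rho> + \<alpha>) \<Upsilon> x"
    unfolding gamma_series_def
    by (intro suminf_mult summable_norm_cancel[OF summable_norm_gamma_term] c \<Upsilon> x)
  finally show "integral\<^sup>L lborel f = Gamma \<alpha> * gamma_series c (\<rho> + \<alpha>) \<Upsilon> x" .
qed

text \<open>Translation of the base point from 0 to \<open>A\<close>. The series representation is
  assumed only to the right of \<open>A\<close>, which is where the integrand lives.\<close>

lemma RL_gamma_series:
  assumes c: "geometrically_bounded c" and \<Upsilon>: "Re \<Upsilon> > 0" and \<alpha>: "Re \<alpha> > 0" and \<rho>: "Re \<rho> > 0"
    and x: "x > A" and f: "\<And>t. t > A \<Longrightarrow> f t = gamma_series c \<rho> \<Upsilon> (t - A)"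
  shows "set_integrable lborel {A<..<x} (RL_integrand x \<alpha> f)"
    and "RL_integral A \<alpha> f x = gamma_series c (\<rho> + \<alpha>) \<Upsilon> (x - A)"
proof -
  define h where "h t = indicat_real {0<..<x - A} t *\<^sub>R
      (of_real (x - A - t) powr (\<alpha> - 1) * gamma_series c \<rho> \<Upsilon> t)" for t
  have "has_bochner_integral lborel h (Gamma \<alpha> * gamma_series c (\<rho> + \<alpha>) \<Upsilon> (x - A))"
    using integral_RL_gamma_series[OF c \<Upsilon> \<alpha> \<rho>, of "x - A"] x
    by (simp add: h_def[abs_def] has_bochner_integral_iff)
  then have "has_bochner_integral lborel (\<lambda>t. h (- A + 1 * t)) (Gamma \<alpha> * gamma_series c (\<rho> + \<alpha>) \<Upsilon> (x - A))"
    by (subst (asm) lborel_has_bochner_integral_real_affine_iff[of 1 _ _ "- A"]) auto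
  also have "(\<lambda>t. h (- A + 1 * t)) = (\<lambda>t. indicat_real {A<..<x} t *\<^sub>R RL_integrand x \<alpha> f t)"
    by (auto simp: h_def RL_integrand_def f indicator_def fun_eq_iff)
  finally have *: "has_bochner_integral lborel (\<lambda>t. indicat_real {A<..<x} t *\<^sub>R RL_integrand x \<alpha> f t)
    (Gamma \<alpha> * gamma_series c (\<rho> + \<alpha>) \<Upsilon> (x - A))" .
  then show "set_integrable lborel {A<..<x} (RL_integrand x \<alpha> f)"
    by (simp add: set_integrable_def has_bochner_integral_iff)
  show "RL_integral A \<alpha> f x = gamma_series c (\<rho> + \<alpha>) \<Upsilon> (x - A)"
    using has_bochner_integral_integral_eq[OF *] Gamma_neq_0_Re_pos[OF \<alpha>]
    by (simp add: RL_integral_def set_lebesgue_integral_def)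
qed

lemma has_vector_derivative_shifted_gamma_series:
  assumes c: "geometrically_bounded c" and \<Upsilon>: "Re \<Upsilon> > 0" and x: "x > A"
    and f: "\<And>t. t > A \<Longrightarrow> f t = gamma_series c \<rho> \<Upsilon> (t - A)"
  shows "(f has_vector_derivative gamma_series c (\<rho> - 1) \<Upsilon> (x - A)) (at x)"
proof -
  have "((\<lambda>t. t - A) has_vector_derivative 1) (at x)"
    by (auto intro!: derivative_eq_intros)
  from vector_diff_chain_at[OF this has_vector_derivative_gamma_series[OF c \<Upsilon>]]
  have "((\<lambda>t. gamma_series c \<rho> \<Upsilon> (t - A)) has_vector_derivative gamma_series c (\<rho> - 1) \<Upsilon> (x - A)) (at x)"
    using x by (simp add: o_def)
  then show ?thesis
    by (rule has_vector_derivative_transform_within_open[of _ _ _ "{A<..}"]) (use f x in auto)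
qed

section \<open>Double series\<close>

text \<open>Fubini for series: the product majorant gives absolute summability, and one of the two
  sums is read as an integral over the counting measure.\<close>

lemma suminf_swap:
  fixes f :: "nat \<Rightarrow> nat \<Rightarrow> complex"
  assumes f: "\<And>s r. norm (f s r) \<le> u s * v r" and u: "summable u" and v: "summable v"
  shows "(\<Sum>s. \<Sum>r. f s r) = (\<Sum>r. \<Sum>s. f s r)"
proof -
  let ?M = "count_space (UNIV :: nat set)"
  have rows: "summable (\<lambda>r. norm (f s r))" for s
    using f by (intro summable_comparison_test'[OF summable_mult[OF v, of "u s"]]) auto
  have cols: "summable (\<lambda>s. norm (f s r))" for r
    using f by (intro summable_comparison_test'[OF summable_mult2[OF u, of "v r"]]) auto
  have int: "integrable ?M (f s)" for s
    using rows by (simp add: integrable_count_space_nat_iff)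
  have "(\<integral>r. norm (f s r) \<partial>?M) \<le> u s * suminf v" for s
  proof -
    have "(\<integral>r. norm (f s r) \<partial>?M) = (\<Sum>r. norm (f s r))"
      using rows by (intro integral_count_space_nat) (simp add: integrable_count_space_nat_iff)
    also have "\<dots> \<le> (\<Sum>r. u s * v r)"
      by (intro suminf_le f rows summable_mult v)
    also have "\<dots> = u s * suminf v" by (rule suminf_mult[OF v])
    finally show ?thesis .
  qed
  then have sum: "summable (\<lambda>s. \<integral>r. norm (f s r) \<partial>?M)"
    by (intro summable_comparison_test'[OF summable_mult2[OF u, of "suminf v"]]) auto
  note swap = int AE_I2[OF cols] sum
  have "(\<Sum>r. \<Sum>s. f s r) = (\<integral>r. (\<Sum>s. f s r) \<partial>?M)"
    by (intro integral_count_space_nat[symmetric] integrable_suminf swap)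
  also have "\<dots> = (\<Sum>s. \<integral>r. f s r \<partial>?M)"
    by (intro integral_suminf swap)
  also have "\<dots> = (\<Sum>s. \<Sum>r. f s r)"
    using int by (intro suminf_cong integral_count_space_nat)
  finally show ?thesis by simp
qed

section \<open>Iterated series in two variables\<close>

definition doubly_geometrically_bounded :: "(nat \<Rightarrow> nat \<Rightarrow> complex) \<Rightarrow> bool" where
  "doubly_geometrically_bounded T \<longleftrightarrow>
     (\<exists>K P Q. P \<ge> 0 \<and> Q \<ge> 0 \<and> (\<forall>s r. norm (T s r) \<le> K * P ^ s * Q ^ r))"

lemma doubly_geometrically_bounded_transpose:
  "doubly_geometrically_bounded T \<Longrightarrow> doubly_geometrically_bounded (\<lambda>r s. T s r)"
  unfolding doubly_geometrically_bounded_def by (metis mult.assoc mult.commute)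

lemma doubly_geometrically_bounded_row:
  "doubly_geometrically_bounded T \<Longrightarrow> geometrically_bounded (T s)"
  unfolding doubly_geometrically_bounded_def geometrically_bounded_def by blast

lemma geometrically_bounded_power: "P \<ge> 0 \<Longrightarrow> geometrically_bounded (\<lambda>s. of_real P ^ s)"
  unfolding geometrically_bounded_def by (rule exI[of _ 1], rule exI[of _ P]) (simp add: norm_power)

lemma gamma_term_coeff: "gamma_term c \<rho> \<Upsilon> r y = c r * gamma_term (\<lambda>_. 1) \<rho> \<Upsilon> r y"
  by (simp add: gamma_term_def)

lemma summable_power_gamma_term:
  assumes "P \<ge> 0" "Re \<Upsilon> > 0" "y > 0"
  shows "summable (\<lambda>r. P ^ r * norm (gamma_term (\<lambda>_. 1) \<rho> \<Upsilon> r y))"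
  using summable_norm_gamma_term[OF geometrically_bounded_power[OF assms(1)] assms(2,3), of \<rho>] assms(1)
  by (subst (asm) gamma_term_coeff) (simp add: norm_mult norm_power)

text \<open>Lets the values of the inner series serve as coefficients of an outer one: the bound on
  \<open>T s r\<close> factors, so the sum over \<open>r\<close> is a constant independent of
  \<open>s\<close>.\<close>

lemma geometrically_bounded_gamma_series:
  assumes T: "doubly_geometrically_bounded T" and \<Upsilon>: "Re \<Upsilon> > 0" and y: "y > 0"
  shows "geometrically_bounded (\<lambda>s. gamma_series (T s) \<rho> \<Upsilon> y)"
proof -
  obtain K P Q where PQ: "P \<ge> 0" "Q \<ge> 0" and bound: "\<And>s r. norm (T s r) \<le> K * P ^ s * Q ^ r"
    using T unfolding doubly_geometrically_bounded_def by metis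
  let ?e = "\<lambda>r. norm (gamma_term (\<lambda>_. 1) \<rho> \<Upsilon> r y)"
  have "norm (gamma_series (T s) \<rho> \<Upsilon> y) \<le> (K * (\<Sum>r. Q ^ r * ?e r)) * P ^ s" for s
  proof -
    have sum: "summable (\<lambda>r. norm (gamma_term (T s) \<rho> \<Upsilon> r y))"
      by (intro summable_norm_gamma_term doubly_geometrically_bounded_row T \<Upsilon> y)
    have "norm (gamma_series (T s) \<rho> \<Upsilon> y) \<le> (\<Sum>r. norm (gamma_term (T s) \<rho> \<Upsilon> r y))"
      unfolding gamma_series_def by (rule summable_norm[OF sum])
    also have "\<dots> \<le> (\<Sum>r. K * P ^ s * (Q ^ r * ?e r))"
    proof (intro suminf_le sum summable_mult summable_power_gamma_term PQ \<Upsilon> y)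
      show "norm (gamma_term (T s) \<rho> \<Upsilon> r y) \<le> K * P ^ s * (Q ^ r * ?e r)" for r
        using mult_right_mono[OF bound[of s r], of "?e r"]
        by (subst gamma_term_coeff) (simp add: norm_mult mult_ac)
    qed
    also have "\<dots> = (K * (\<Sum>r. Q ^ r * ?e r)) * P ^ s"
      using PQ \<Upsilon> y by (subst suminf_mult) (auto intro: summable_power_gamma_term)
    finally show ?thesis .
  qed
  then show ?thesis using PQ unfolding geometrically_bounded_def by blast
qed

text \<open>The series in \<open>y\<close> is nested inside, so for fixed \<open>y\<close> this is a
  one-variable series in \<open>x\<close>. The general step \<Xi> makes the two variables
  interchangeable; the Mittag-Leffler case is \<open>\<Xi> = 1\<close>.\<close>

definition gamma_series2 ::
  "(nat \<Rightarrow> nat \<Rightarrow> complex) \<Rightarrow> complex \<Rightarrow> complex \<Rightarrow> complex \<Rightarrow> complex \<Rightarrow> real \<Rightarrow> real \<Rightarrow> complex" where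
  "gamma_series2 T \<kappa> \<Xi> \<rho> \<Upsilon> x y = gamma_series (\<lambda>s. gamma_series (T s) \<rho> \<Upsilon> y) \<kappa> \<Xi> x"

lemma gamma_series2_eq_suminf:
  assumes T: "doubly_geometrically_bounded T" and "Re \<Upsilon> > 0" "y > 0"
  shows "gamma_series2 T \<kappa> \<Xi> \<rho> \<Upsilon> x y
    = (\<Sum>s. \<Sum>r. T s r * gamma_term (\<lambda>_. 1) \<kappa> \<Xi> s x * gamma_term (\<lambda>_. 1) \<rho> \<Upsilon> r y)"
proof -
  have "gamma_series (T s) \<rho> \<Upsilon> y * gamma_term (\<lambda>_. 1) \<kappa> \<Xi> s x
      = (\<Sum>r. T s r * gamma_term (\<lambda>_. 1) \<kappa> \<Xi> s x * gamma_term (\<lambda>_. 1) \<rho> \<Upsilon> r y)" for s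
    unfolding gamma_series_def
    using summable_norm_cancel[OF summable_norm_gamma_term[OF doubly_geometrically_bounded_row[OF T, of s] assms(2,3)]]
    by (subst suminf_mult2) (simp_all add: gamma_term_coeff[of "T s"] mult_ac)
  then show ?thesis
    by (simp add: gamma_series2_def gamma_series_def[of "\<lambda>s. gamma_series (T s) \<rho> \<Upsilon> y"]
        gamma_term_coeff[of "\<lambda>s. gamma_series (T s) \<rho> \<Upsilon> y"])
qed

text \<open>With the roles of the variables exchanged, operators in \<open>y\<close> also act on a
  one-variable series. The majorant is a product of a summable sequence in \<open>s\<close> and one
  in \<open>r\<close>.\<close>

lemma gamma_series2_swap:
  assumes T: "doubly_geometrically_bounded T"
    and "Re \<Xi> > 0" "Re \<Upsilon> > 0" "x > 0" "y > 0"
  shows "gamma_series2 T \<kappa> \<Xi> \<rho> \<Upsilon> x y = gamma_series (\<lambda>r. gamma_series (\<lambda>s. T s r) \<kappa> \<Xi> x) \<rho> \<Upsilon> y"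
proof -
  obtain K P Q where PQ: "P \<ge> 0" "Q \<ge> 0" and bound: "\<And>s r. norm (T s r) \<le> K * P ^ s * Q ^ r"
    using T unfolding doubly_geometrically_bounded_def by metis
  let ?e = "\<lambda>s. gamma_term (\<lambda>_. 1) \<kappa> \<Xi> s x" and ?e' = "\<lambda>r. gamma_term (\<lambda>_. 1) \<rho> \<Upsilon> r y"
  have "norm (T s r * ?e s * ?e' r) \<le> (K * (P ^ s * norm (?e s))) * (Q ^ r * norm (?e' r))" for s r
    using mult_right_mono[OF bound[of s r], of "norm (?e s) * norm (?e' r)"]
    by (simp add: norm_mult mult_ac)
  then have "(\<Sum>s. \<Sum>r. T s r * ?e s * ?e' r) = (\<Sum>r. \<Sum>s. T s r * ?e s * ?e' r)"
    by (rule suminf_swap) (intro summable_mult summable_power_gamma_term PQ assms)+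
  then show ?thesis
    using gamma_series2_eq_suminf[OF T assms(3,5), of \<kappa> \<Xi> \<rho> x]
      gamma_series2_eq_suminf[OF doubly_geometrically_bounded_transpose[OF T] assms(2,4), of \<rho> \<Upsilon> \<kappa> y]
    by (simp add: gamma_series2_def mult_ac)
qed

section \<open>Fractional integrals and derivatives of series on the quadrant\<close>

text \<open>The invariant carried through all operators: \<open>T\<close>, \<Xi> and \<Upsilon> stay
  fixed while \<kappa> and \<rho> shift. Values off the open quadrant are left free, since there the
  operators may return default values.\<close>

definition quadrant_series ::
  "real \<Rightarrow> real \<Rightarrow> (nat \<Rightarrow> nat \<Rightarrow> complex) \<Rightarrow> complex \<Rightarrow> complex \<Rightarrow> complex \<Rightarrow> complex
     \<Rightarrow> (real \<Rightarrow> real \<Rightarrow> complex) \<Rightarrow> bool" where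
  "quadrant_series A B T \<kappa> \<Xi> \<rho> \<Upsilon> F \<longleftrightarrow>
     (\<forall>x>A. \<forall>y>B. F x y = gamma_series2 T \<kappa> \<Xi> \<rho> \<Upsilon> (x - A) (y - B))"

context
  fixes A B :: real and T :: "nat \<Rightarrow> nat \<Rightarrow> complex" and \<Xi> \<Upsilon> :: complex
  assumes T: "doubly_geometrically_bounded T" and \<Xi>: "Re \<Xi> > 0" and \<Upsilon>: "Re \<Upsilon> > 0"
begin

lemma quadrant_series_X:
  assumes "quadrant_series A B T \<kappa> \<Xi> \<rho> \<Upsilon> F" "x > A" "y > B"
  shows "F x y = gamma_series (\<lambda>s. gamma_series (T s) \<rho> \<Upsilon> (y - B)) \<kappa> \<Xi> (x - A)"
  using assms by (simp add: quadrant_series_def gamma_series2_def)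

lemma quadrant_series_Y:
  assumes "quadrant_series A B T \<kappa> \<Xi> \<rho> \<Upsilon> F" "x > A" "y > B"
  shows "F x y = gamma_series (\<lambda>r. gamma_series (\<lambda>s. T s r) \<kappa> \<Xi> (x - A)) \<rho> \<Upsilon> (y - B)"
  using assms gamma_series2_swap[OF T \<Xi> \<Upsilon>] by (simp add: quadrant_series_def)

lemma geometrically_bounded_X: "y > B \<Longrightarrow> geometrically_bounded (\<lambda>s. gamma_series (T s) \<rho> \<Upsilon> (y - B))"
  by (intro geometrically_bounded_gamma_series T \<Upsilon>) simp

lemma geometrically_bounded_Y: "x > A \<Longrightarrow> geometrically_bounded (\<lambda>r. gamma_series (\<lambda>s. T s r) \<kappa> \<Xi> (x - A))"
  by (intro geometrically_bounded_gamma_series doubly_geometrically_bounded_transpose[OF T] \<Xi>) simp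

lemma quadrant_series_derivative_X:
  assumes "quadrant_series A B T \<kappa> \<Xi> \<rho> \<Upsilon> F" "x > A" "y > B"
  shows "((\<lambda>t. F t y) has_vector_derivative gamma_series2 T (\<kappa> - 1) \<Xi> \<rho> \<Upsilon> (x - A) (y - B)) (at x)"
  unfolding gamma_series2_def
  by (intro has_vector_derivative_shifted_gamma_series geometrically_bounded_X quadrant_series_X[OF assms(1)] \<Xi> assms)

lemma quadrant_series_derivative_Y:
  assumes "quadrant_series A B T \<kappa> \<Xi> \<rho> \<Upsilon> F" "x > A" "y > B"
  shows "((\<lambda>t. F x t) has_vector_derivative gamma_series2 T \<kappa> \<Xi> (\<rho> - 1) \<Upsilon> (x - A) (y - B)) (at y)"
proof -
  have "gamma_series2 T \<kappa> \<Xi> (\<rho> - 1) \<Upsilon> (x - A) (y - B)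
      = gamma_series (\<lambda>r. gamma_series (\<lambda>s. T s r) \<kappa> \<Xi> (x - A)) (\<rho> - 1) \<Upsilon> (y - B)"
    using assms by (intro gamma_series2_swap T \<Xi> \<Upsilon>) auto
  then show ?thesis
    by (simp only:)
       (intro has_vector_derivative_shifted_gamma_series geometrically_bounded_Y quadrant_series_Y[OF assms(1)] \<Upsilon> assms)
qed

lemma quadrant_series_partial_X:
  assumes "quadrant_series A B T \<kappa> \<Xi> \<rho> \<Upsilon> F"
  shows "quadrant_series A B T (\<kappa> - of_nat n) \<Xi> \<rho> \<Upsilon> ((partial_X ^^ n) F)"
proof (induction n)
  case (Suc n)
  show ?case
    using quadrant_series_derivative_X[OF Suc, THEN vector_derivative_at]
    by (simp add: quadrant_series_def partial_X_def algebra_simps)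
qed (use assms in simp)

lemma quadrant_series_partial_Y:
  assumes "quadrant_series A B T \<kappa> \<Xi> \<rho> \<Upsilon> F"
  shows "quadrant_series A B T \<kappa> \<Xi> (\<rho> - of_nat n) \<Upsilon> ((partial_Y ^^ n) F)"
proof (induction n)
  case (Suc n)
  show ?case
    using quadrant_series_derivative_Y[OF Suc, THEN vector_derivative_at]
    by (simp add: quadrant_series_def partial_Y_def algebra_simps)
qed (use assms in simp)

lemma quadrant_series_RL_integral_X:
  assumes F: "quadrant_series A B T \<kappa> \<Xi> \<rho> \<Upsilon> F" and "Re \<kappa> > 0" and \<alpha>: "Re \<alpha> > 0"
  shows "quadrant_series A B T (\<kappa> + \<alpha>) \<Xi> \<rho> \<Upsilon> (RL_integral_X A \<alpha> F)"
    and "x > A \<Longrightarrow> y > B \<Longrightarrow> set_integrable lborel {A<..<x} (RL_integrand x \<alpha> (\<lambda>t. F t y))"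
  using RL_gamma_series[OF geometrically_bounded_X \<Xi> \<alpha> assms(2)] quadrant_series_X[OF F]
  by (auto simp: quadrant_series_def RL_integral_X_def gamma_series2_def)

lemma quadrant_series_RL_integral_Y:
  assumes F: "quadrant_series A B T \<kappa> \<Xi> \<rho> \<Upsilon> F" and "Re \<rho> > 0" and \<alpha>: "Re \<alpha> > 0"
  shows "quadrant_series A B T \<kappa> \<Xi> (\<rho> + \<alpha>) \<Upsilon> (RL_integral_Y B \<alpha> F)"
    and "x > A \<Longrightarrow> y > B \<Longrightarrow> set_integrable lborel {B<..<y} (RL_integrand y \<alpha> (F x))"
  using RL_gamma_series[OF geometrically_bounded_Y \<Upsilon> \<alpha> assms(2)] quadrant_series_Y[OF F]
  by (auto simp: quadrant_series_def RL_integral_Y_def gamma_series2_swap[OF T \<Xi> \<Upsilon>])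

text \<open>The floor plus one strictly exceeds the real part, and \<open>Re \<mu> >= 0\<close>
  makes the conversion by \<open>nat\<close> harmless.\<close>

lemma Re_RL_order: "Re \<mu> \<ge> 0 \<Longrightarrow> Re (of_nat (RL_order \<mu>) - \<mu>) > 0"
  unfolding RL_order_def by simp linarith

text \<open>The integrals come first, while \<kappa> and \<rho> still have positive real part; the
  derivatives then undo the integer part of the shift. Each stage supplies genuine integrability or
  differentiability, whence the existence claim.\<close>

theorem quadrant_series_RL_derivative:
  assumes F: "quadrant_series A B T \<kappa> \<Xi> \<rho> \<Upsilon> F"
    and "Re \<kappa> > 0" "Re \<rho> > 0" "Re \<mu> \<ge> 0" "Re \<zeta> \<ge> 0"
  shows "RL_derivative_exists A B \<mu> \<zeta> F"
    and "quadrant_series A B T (\<kappa> - \<mu>) \<Xi> (\<rho> - \<zeta>) \<Upsilon> (RL_derivative A B \<mu> \<zeta> F)"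
proof -
  let ?\<alpha> = "of_nat (RL_order \<mu>) - \<mu>" and ?\<beta> = "of_nat (RL_order \<zeta>) - \<zeta>"
  note \<alpha> = Re_RL_order[OF assms(4)] and \<beta> = Re_RL_order[OF assms(5)]
  note IY = quadrant_series_RL_integral_Y[OF F assms(3) \<beta>]
  note IX = quadrant_series_RL_integral_X[OF IY(1) assms(2) \<alpha>]
  have P: "quadrant_series A B T (\<kappa> + ?\<alpha>) \<Xi> (\<rho> + ?\<beta>) \<Upsilon> (RL_potential A B \<mu> \<zeta> F)"
    using IX(1) by (simp add: RL_potential_def)
  \<comment> \<open>Both facts are schematic in the number of derivatives: all the iterates give the
    differentiability claims, the last ones the formula.\<close>
  note PY = quadrant_series_partial_Y[OF P]
  note PX = quadrant_series_partial_X[OF PY]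
  show "RL_derivative_exists A B \<mu> \<zeta> F"
    unfolding RL_derivative_exists_def
    by (intro allI impI conjI IY(2) IX(2) quadrant_series_derivative_Y[OF PY, THEN differentiableI_vector]
      quadrant_series_derivative_X[OF PX, THEN differentiableI_vector])
  have "\<kappa> + ?\<alpha> - of_nat (RL_order \<mu>) = \<kappa> - \<mu>" "\<rho> + ?\<beta> - of_nat (RL_order \<zeta>) = \<rho> - \<zeta>"
    by simp_all
  then show "quadrant_series A B T (\<kappa> - \<mu>) \<Xi> (\<rho> - \<zeta>) \<Upsilon> (RL_derivative A B \<mu> \<zeta> F)"
    using PX[of "RL_order \<mu>" "RL_order \<zeta>"] by (simp add: RL_derivative_def)
qed

end

section \<open>Growth of the Mittag-Leffler coefficients\<close>

text \<open>Factor by factor, \<open>norm (a + k)\<close> is at most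
  \<open>(1 + norm a) * (1 + k)\<close>.\<close>

lemma norm_pochhammer_le:
  fixes a :: complex
  shows "norm (pochhammer a n) \<le> (1 + norm a) ^ n * fact n"
proof (induction n)
  case (Suc n)
  have "norm (a + of_nat n) \<le> norm a + real n"
    by (metis norm_triangle_ineq norm_of_nat)
  also have "\<dots> \<le> (1 + norm a) * (1 + real n)" by (simp add: algebra_simps)
  finally have "norm (pochhammer a n) * norm (a + of_nat n)
      \<le> ((1 + norm a) ^ n * fact n) * ((1 + norm a) * (1 + real n))"
    using Suc by (intro mult_mono) auto
  then show ?case by (simp add: pochhammer_Suc norm_mult mult_ac)
qed simp

text \<open>Factor by factor, \<open>norm (a + k)\<close> is at least \<open>Re a + k\<close>, hence
  at least \<open>min (Re a) 1 * (1 + k)\<close>.\<close>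

lemma norm_pochhammer_ge:
  fixes a :: complex
  assumes "Re a > 0"
  shows "min (Re a) 1 ^ n * fact n \<le> norm (pochhammer a n)"
proof (induction n)
  case (Suc n)
  have "min (Re a) 1 * (1 + real n) = min (Re a) 1 + min (Re a) 1 * real n"
    by (simp add: algebra_simps)
  also have "\<dots> \<le> Re a + 1 * real n"
    by (intro add_mono mult_right_mono) auto
  also have "\<dots> \<le> norm (a + of_nat n)"
    using complex_Re_le_cmod[of "a + of_nat n"] by simp
  finally have "(min (Re a) 1 ^ n * fact n) * (min (Re a) 1 * (1 + real n))
      \<le> norm (pochhammer a n) * norm (a + of_nat n)"
    using Suc assms by (intro mult_mono) auto
  then show ?case by (simp add: pochhammer_Suc norm_mult mult_ac)
qed simp

text \<open>The quotient of factorials is a binomial coefficient, hence at most the full power of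
  2.\<close>

lemma fact_add_le: "(fact (m + n) :: real) \<le> 2 ^ (m + n) * (fact m * fact n)"
proof -
  have "fact m * fact n * ((m + n) choose m) = (fact (m + n) :: nat)"
    using binomial_fact_lemma[of m "m + n"] by simp
  then have "(fact (m + n) :: nat) \<le> fact m * fact n * 2 ^ (m + n)"
    by (metis binomial_le_pow2 mult_le_mono2)
  then have "real (fact (m + n)) \<le> real (fact m * fact n * 2 ^ (m + n))"
    by (simp only: of_nat_le_iff)
  then show ?thesis by (simp add: mult_ac)
qed

text \<open>The Mittag-Leffler summand without its two \<open>rGamma\<close> factors. Here
  \<open>x\<close> and \<open>v\<close> stand for the constants \<omega>1 and \<open>w\<close>; the
  actual variables enter through \<open>gamma_term\<close>.\<close>

definition HK_coeff ::
  "complex \<Rightarrow> complex \<Rightarrow> complex \<Rightarrow> complex \<Rightarrow> complex \<Rightarrow> complex \<Rightarrow> nat \<Rightarrow> nat \<Rightarrow> complex" where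
  "HK_coeff \<gamma>1 \<gamma>2 \<gamma>3 \<gamma>4 x v s r =
     pochhammer \<gamma>1 (2 * s) * pochhammer \<gamma>2 (s + r) * x ^ s * v ^ r
       / (pochhammer \<gamma>3 s * pochhammer \<gamma>4 s * fact r * fact s)"

text \<open>The factorials balance: \<open>(2 * s)!\<close> and \<open>(s + r)!\<close> together
  contribute three copies of \<open>s!\<close> and one of \<open>r!\<close> up to powers of 2,
  exactly as many as the denominator.\<close>

lemma doubly_geometrically_bounded_HK_coeff:
  assumes "Re \<gamma>3 > 0" "Re \<gamma>4 > 0"
  shows "doubly_geometrically_bounded (HK_coeff \<gamma>1 \<gamma>2 \<gamma>3 \<gamma>4 x v)"
proof -
  define a b where "a = 1 + norm \<gamma>1" and "b = 1 + norm \<gamma>2"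
  define c d where "c = min (Re \<gamma>3) 1" and "d = min (Re \<gamma>4) 1"
  have pos: "a > 0" "b > 0" "c > 0" "d > 0"
    using assms by (auto simp: a_def b_def c_def d_def add_pos_nonneg)
  \<comment> \<open>The 8 is the factor 4 from \<open>(2 * s)!\<close> times the factor 2 from
    \<open>(s + r)!\<close>.\<close>
  have "norm (HK_coeff \<gamma>1 \<gamma>2 \<gamma>3 \<gamma>4 x v s r)
      \<le> 1 * (8 * a^2 * b * norm x / (c * d)) ^ s * (2 * b * norm v) ^ r" for s r
  proof -
    have "(fact (2 * s) :: real) \<le> 2 ^ (2 * s) * (fact s * fact s)"
      using fact_add_le[of s s] by (simp add: mult_2)
    then have 1: "norm (pochhammer \<gamma>1 (2 * s)) \<le> a ^ (2 * s) * (2 ^ (2 * s) * (fact s * fact s))"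
      using pos by (intro order_trans[OF norm_pochhammer_le]) (auto simp: a_def)
    have 2: "norm (pochhammer \<gamma>2 (s + r)) \<le> b ^ (s + r) * (2 ^ (s + r) * (fact s * fact r))"
      using pos fact_add_le[of s r] by (intro order_trans[OF norm_pochhammer_le]) (auto simp: b_def)
    have "norm (HK_coeff \<gamma>1 \<gamma>2 \<gamma>3 \<gamma>4 x v s r) =
        norm (pochhammer \<gamma>1 (2 * s)) * norm (pochhammer \<gamma>2 (s + r)) * norm x ^ s * norm v ^ r
          / (norm (pochhammer \<gamma>3 s) * norm (pochhammer \<gamma>4 s) * fact r * fact s)"
      by (simp add: HK_coeff_def norm_mult norm_divide norm_power)
    also have "\<dots> \<le> (a ^ (2 * s) * (2 ^ (2 * s) * (fact s * fact s))) *
        (b ^ (s + r) * (2 ^ (s + r) * (fact s * fact r))) * norm x ^ s * norm v ^ r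
          / ((c ^ s * fact s) * (d ^ s * fact s) * fact r * fact s)"
      using norm_pochhammer_ge[OF assms(1), of s] norm_pochhammer_ge[OF assms(2), of s] 1 2 pos
      by (intro frac_le mult_mono mult_right_mono) (auto simp: c_def d_def)
    also have "\<dots> = a ^ (2 * s) * 2 ^ (2 * s) * b ^ (s + r) * 2 ^ (s + r) * norm x ^ s * norm v ^ r / (c ^ s * d ^ s)"
      by (simp add: divide_simps)
    also have "\<dots> = 1 * (8 * a^2 * b * norm x / (c * d)) ^ s * (2 * b * norm v) ^ r"
    proof -
      have "(8 :: real) ^ s = 2 ^ (2 * s) * 2 ^ s"
        by (simp add: power_mult power_mult_distrib[symmetric])
      then show ?thesis
        by (simp add: power_mult_distrib power_divide power_add power_mult[of a])
    qed
    finally show ?thesis .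
  qed
  then show ?thesis
    unfolding doubly_geometrically_bounded_def using pos
    by (intro exI[of _ 1] exI[of _ "8 * a^2 * b * norm x / (c * d)"] exI[of _ "2 * b * norm v"]) auto
qed

section \<open>Identification with the Mittag-Leffler function\<close>

text \<open>The powers belonging to \<open>s = r = 0\<close> are common to all terms and are pulled
  out. Arbitrary complex \<kappa> and \<rho> are allowed, so this recognises both the given function
  and its fractional derivative.\<close>

lemma gamma_series2_HK_coeff:
  assumes "Re \<gamma>3 > 0" "Re \<gamma>4 > 0" "Re \<Upsilon> > 0" "x > 0" "y > 0"
  shows "gamma_series2 (HK_coeff \<gamma>1 \<gamma>2 \<gamma>3 \<gamma>4 \<omega> w) \<kappa> 1 \<rho> \<Upsilon> x y
    = of_real x powr (\<kappa> - 1) * of_real y powr (\<rho> - 1)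
      * HK_ML \<gamma>1 \<gamma>2 \<gamma>3 \<gamma>4 \<kappa> \<rho> \<Upsilon> (\<omega> * of_real x) (w * of_real y powr \<Upsilon>)"
proof -
  let ?T = "HK_coeff \<gamma>1 \<gamma>2 \<gamma>3 \<gamma>4 \<omega> w"
  note T = doubly_geometrically_bounded_HK_coeff[OF assms(1,2), of \<gamma>1 \<gamma>2 \<omega> w]
  define C where "C = complex_of_real x powr (\<kappa> - 1) * of_real y powr (\<rho> - 1)"
  have C: "C \<noteq> 0" using assms by (simp add: C_def)
  define f where "f s r = ?T s r * gamma_term (\<lambda>_. 1) \<kappa> 1 s x * gamma_term (\<lambda>_. 1) \<rho> \<Upsilon> r y" for s r
  have f: "(\<lambda>r. f s r) sums (gamma_term (\<lambda>s. gamma_series (?T s) \<rho> \<Upsilon> y) \<kappa> 1 s x)" for s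
  proof -
    have "(\<lambda>r. gamma_term (?T s) \<rho> \<Upsilon> r y) sums gamma_series (?T s) \<rho> \<Upsilon> y"
      unfolding gamma_series_def
      by (intro summable_sums summable_norm_cancel[OF summable_norm_gamma_term]
          doubly_geometrically_bounded_row[OF T] assms)
    from sums_mult[OF this, of "gamma_term (\<lambda>_. 1) \<kappa> 1 s x"] show ?thesis
      by (simp add: f_def gamma_term_coeff[of "?T s"] gamma_term_coeff[of "\<lambda>s. gamma_series (?T s) \<rho> \<Upsilon> y"] mult_ac)
  qed
  have F: "(\<lambda>s. gamma_term (\<lambda>s. gamma_series (?T s) \<rho> \<Upsilon> y) \<kappa> 1 s x) sums gamma_series2 ?T \<kappa> 1 \<rho> \<Upsilon> x y"
    unfolding gamma_series2_def gamma_series_def[of "\<lambda>s. gamma_series (?T s) \<rho> \<Upsilon> y"]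
    by (intro summable_sums summable_norm_cancel[OF summable_norm_gamma_term]
        geometrically_bounded_gamma_series T assms) simp
  have "pochhammer \<gamma>1 (2 * s) * pochhammer \<gamma>2 (s + r) * (\<omega> * of_real x) ^ s * (w * of_real y powr \<Upsilon>) ^ r
      * rGamma (\<kappa> + of_nat s) * rGamma (\<rho> + \<Upsilon> * of_nat r)
      / (pochhammer \<gamma>3 s * pochhammer \<gamma>4 s * fact r * fact s) = f s r / C" for s r
  proof -
    have "complex_of_real x powr (\<kappa> + of_nat s - 1) = of_real x powr (\<kappa> - 1) * of_real x ^ s"
      using assms powr_add[of "complex_of_real x" "\<kappa> - 1" "of_nat s"]
      by (simp add: powr_nat algebra_simps)
    moreover have "complex_of_real y powr (\<rho> + \<Upsilon> * of_nat r - 1) = of_real y powr (\<rho> - 1) * (of_real y powr \<Upsilon>) ^ r"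
    proof -
      have "(complex_of_real y powr \<Upsilon>) ^ r = of_real y powr (\<Upsilon> * of_nat r)"
        using assms by (simp add: powr_def exp_of_nat_mult[symmetric] mult_ac)
      then show ?thesis
        using powr_add[of "complex_of_real y" "\<rho> - 1" "\<Upsilon> * of_nat r"] by (simp add: algebra_simps)
    qed
    ultimately have "f s r = C * (pochhammer \<gamma>1 (2 * s) * pochhammer \<gamma>2 (s + r) * (\<omega> * of_real x) ^ s
        * (w * of_real y powr \<Upsilon>) ^ r * rGamma (\<kappa> + of_nat s) * rGamma (\<rho> + \<Upsilon> * of_nat r)
        / (pochhammer \<gamma>3 s * pochhammer \<gamma>4 s * fact r * fact s))"
      by (simp add: f_def gamma_term_def HK_coeff_def C_def power_mult_distrib mult_ac)
    then show ?thesis using C by simp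
  qed
  then have "HK_ML \<gamma>1 \<gamma>2 \<gamma>3 \<gamma>4 \<kappa> \<rho> \<Upsilon> (\<omega> * of_real x) (w * of_real y powr \<Upsilon>) = (\<Sum>s. \<Sum>r. f s r / C)"
    by (simp add: HK_ML_def)
  \<comment> \<open>Dividing both nested sums by \<open>C\<close> relies on their convergence,
    recorded in \<open>f\<close> and \<open>F\<close>.\<close>
  also have "\<dots> = gamma_series2 ?T \<kappa> 1 \<rho> \<Upsilon> x y / C"
    using sums_divide[OF f, where c = C] sums_divide[OF F, where c = C] by (simp add: sums_iff)
  finally show ?thesis using C by (simp add: C_def)
qed

theorem theorem16:
  fixes \<gamma>1 \<gamma>2 \<gamma>3 \<gamma>4 \<kappa> \<rho> \<Upsilon> \<zeta> \<mu> \<omega>1 \<omega>2 w :: complex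
    and A B :: real
    and g :: "real \<Rightarrow> real \<Rightarrow> complex"
  assumes "Re \<gamma>1 > 0" "Re \<gamma>2 > 0" "Re \<gamma>3 > 0" "Re \<gamma>4 > 0"
    and "Re \<kappa> > 0" "Re \<rho> > 0" "Re \<Upsilon> > 0"
    and "Re \<zeta> \<ge> 0" "Re \<mu> \<ge> 0"
    and "is_power_value \<omega>2 \<Upsilon> w"
  defines "g \<equiv> (\<lambda>x y. of_real (x - A) powr (\<kappa> - 1) * of_real (y - B) powr (\<rho> - 1)
                 * HK_ML \<gamma>1 \<gamma>2 \<gamma>3 \<gamma>4 \<kappa> \<rho> \<Upsilon>
                     (\<omega>1 * of_real (x - A)) (w * of_real (y - B) powr \<Upsilon>))"
  shows "RL_derivative_exists A B \<mu> \<zeta> g \<and>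
         (\<forall>X>A. \<forall>Y>B.
            RL_derivative A B \<mu> \<zeta> g X Y =
              of_real (X - A) powr (\<kappa> - \<mu> - 1) * of_real (Y - B) powr (\<rho> - \<zeta> - 1)
              * HK_ML \<gamma>1 \<gamma>2 \<gamma>3 \<gamma>4 (\<kappa> - \<mu>) (\<rho> - \<zeta>) \<Upsilon>
                  (\<omega>1 * of_real (X - A)) (w * of_real (Y - B) powr \<Upsilon>))"
proof -
  let ?T = "HK_coeff \<gamma>1 \<gamma>2 \<gamma>3 \<gamma>4 \<omega>1 w"
  have T: "doubly_geometrically_bounded ?T"
    using assms(3,4) by (rule doubly_geometrically_bounded_HK_coeff)
  note eq = gamma_series2_HK_coeff[OF assms(3,4,7)]
  have "quadrant_series A B ?T \<kappa> 1 \<rho> \<Upsilon> g"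
    unfolding quadrant_series_def g_def by (simp add: eq del: of_real_diff)
  \<comment> \<open>The premise left open is \<open>Re 1 > 0\<close>, for \<open>\<Xi> = 1\<close>;
    the last two assumptions are swapped because the condition on \<mu> comes first.\<close>
  note RL = quadrant_series_RL_derivative[OF T _ assms(7) this assms(5,6,9,8)]
  show ?thesis
    using RL unfolding quadrant_series_def by (simp add: eq del: of_real_diff)
qed

end
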